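(* Let $G$ and $H$ be two nonempty and noncomplete graphs of order $n$ and $n'$, respectively. Then $$\gamma_{\rm sp}(G+H)=\min\{\,n+n'-2,\ n+\gamma_{\rm sp}(H),\ n'+\gamma_{\rm sp}(G)\,\}.$$
   Context: All graphs are finite, simple and undirected; the order of a graph is its number of vertices. A nonempty graph is one with at least one edge. For a vertex $v$ of $G$, $N(v)$ is the set of vertices adjacent to $v$, and for $D\subseteq V(G)$, $\overline{D}=V(G)\setminus D$. A set $D\subseteq V(G)$ is a super dominating set of $G$ if for every $u\in\overline{D}$ there exists $v\in D$ such that $N(v)\cap\overline{D}=\{u\}$. The super domination number $\gamma_{\rm sp}(G)$ is the minimum cardinality of a super dominating set of $G$. The join $G+H$ is the graph obtained from disjoint copies of $G$ and $H$ by joining by an edge each vertex of $G$ with each vertex of $H$. *)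

theory Defs
  imports "Graph_Theory.Graph_Theory"
begin

text \<open>
  Finite simple undirected graphs are represented by the locale \<^locale>\<open>pair_graph\<close>: finite,
  loop-free symmetric digraphs without parallel arcs, an edge $uv$ being the pair of arcs
  $(u,v)$, $(v,u)$.
\<close>

definition neighbourhood :: "'a pair_pre_digraph \<Rightarrow> 'a \<Rightarrow> 'a set" where
  "neighbourhood G v = {u \<in> pverts G. (v, u) \<in> parcs G}"

definition super_dominating :: "'a pair_pre_digraph \<Rightarrow> 'a set \<Rightarrow> bool" where
  "super_dominating G D \<longleftrightarrow>
     D \<subseteq> pverts G \<and>
     (\<forall>u \<in> pverts G - D. \<exists>v \<in> D. neighbourhood G v \<inter> (pverts G - D) = {u})"

definition super_domination_number :: "'a pair_pre_digraph \<Rightarrow> nat" where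
  "super_domination_number G = Min (card ` {D. super_dominating G D})"

lemma super_dominating_pverts: "super_dominating G (pverts G)"
  by (simp add: super_dominating_def)

lemma finite_super_dominating:
  assumes "finite (pverts G)"
  shows "finite {D. super_dominating G D}"
  by (rule finite_subset[of _ "Pow (pverts G)"]) (use assms in \<open>auto simp: super_dominating_def\<close>)

text \<open>The disjoint copies of the two vertex sets are the two summands of the sum type.\<close>

definition graph_join ::
    "'a pair_pre_digraph \<Rightarrow> 'b pair_pre_digraph \<Rightarrow> ('a + 'b) pair_pre_digraph" where
  "graph_join G H =
     \<lparr> pverts = pverts G <+> pverts H,
       parcs = map_prod Inl Inl ` parcs G \<union> map_prod Inr Inr ` parcs H
             \<union> (Inl ` pverts G) \<times> (Inr ` pverts H) \<union> (Inr ` pverts H) \<times> (Inl ` pverts G) \<rparr>"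

lemma pair_graph_graph_join:
  assumes "pair_graph G" "pair_graph H"
  shows "pair_graph (graph_join G H)"
proof -
  interpret G: pair_graph G by fact
  interpret H: pair_graph H by fact
  have sG: "sym (parcs G)" and sH: "sym (parcs H)"
    using G.sym_arcs H.sym_arcs by (auto simp: symmetric_def)
  show ?thesis
  proof
    show "finite (pverts (graph_join G H))"
      by (simp add: graph_join_def)
    show "finite (parcs (graph_join G H))"
      by (simp add: graph_join_def)
    show "symmetric (with_proj (graph_join G H))"
      using sG sH by (auto simp: graph_join_def symmetric_def sym_def)
  qed (use G.pair_no_loops H.pair_no_loops in
       \<open>auto simp: graph_join_def G.in_arcsD1 G.in_arcsD2 H.in_arcsD1 H.in_arcsD2\<close>)
qed

end

theory Submission
  imports Defs
begin

text \<open>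
  Only one idea is needed: in \<open>G + H\<close> a vertex of \<open>H\<close> sees every vertex of \<open>G\<close>, and conversely.
  So if \<open>U\<close> is the complement of a super dominating set \<open>D\<close> of the join, a vertex of \<open>D\<close> in \<open>H\<close>
  can single out a vertex of \<open>U \<inter> G\<close> only if that is the only vertex of \<open>U \<inter> G\<close>, and a vertex of
  \<open>D\<close> in \<open>G\<close> can single out a vertex of \<open>G\<close> only if \<open>U\<close> misses \<open>H\<close>. Lemma
  \<open>super_dominating_join_iff\<close> records this as a description of the super dominating sets of the
  join that mentions the two factors only.

  The lower bound follows by looking at which sides \<open>U\<close> meets
  (\<open>super_dominating_join_cases\<close>): if it meets both sides, it has one vertex on each; if it meets
  only \<open>G\<close>, then either it is a single vertex or all the dominators lie in \<open>G\<close>, so that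
  \<open>D \<inter> G\<close> is super dominating in \<open>G\<close>. For the upper bound, super dominating sets
  of one factor extend by the whole other factor. The value \<open>n + n' - 2\<close> is attained by choosing
  nonadjacent pairs \<open>u, x\<close> in \<open>G\<close> and \<open>w, y\<close> in \<open>H\<close>, which exist as neither graph is complete, and
  removing \<open>u\<close> and \<open>w\<close>: now \<open>y\<close> sees \<open>u\<close> but not \<open>w\<close>, and \<open>x\<close> sees \<open>w\<close> but not \<open>u\<close>.
\<close>

section \<open>Super dominating sets of a join\<close>

lemma pverts_graph_join: "pverts (graph_join G H) = pverts G <+> pverts H"
  by (simp add: graph_join_def)

lemma neighbourhood_join_Inl:
  assumes "v \<in> pverts G"
  shows "neighbourhood (graph_join G H) (Inl v) = neighbourhood G v <+> pverts H"
  using assms by (auto simp: neighbourhood_def graph_join_def)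

lemma neighbourhood_join_Inr:
  assumes "v \<in> pverts H"
  shows "neighbourhood (graph_join G H) (Inr v) = pverts G <+> neighbourhood H v"
  using assms by (auto simp: neighbourhood_def graph_join_def)

lemma private_neighbour_join_Inl:
  assumes "v \<in> pverts G" "A \<subseteq> pverts G" "B \<subseteq> pverts H"
  shows "neighbourhood (graph_join G H) (Inl v) \<inter> (pverts (graph_join G H) - (A <+> B)) = {Inl u}
           \<longleftrightarrow> B = pverts H \<and> neighbourhood G v \<inter> (pverts G - A) = {u}"
    and "neighbourhood (graph_join G H) (Inl v) \<inter> (pverts (graph_join G H) - (A <+> B)) = {Inr w}
           \<longleftrightarrow> pverts H - B = {w} \<and> neighbourhood G v \<inter> (pverts G - A) = {}"
proof -
  have *: "neighbourhood (graph_join G H) (Inl v) \<inter> (pverts (graph_join G H) - (A <+> B)) =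
      Inl ` (neighbourhood G v \<inter> (pverts G - A)) \<union> Inr ` (pverts H - B)"
    using assms(1) by (auto simp: neighbourhood_join_Inl pverts_graph_join)
  show "neighbourhood (graph_join G H) (Inl v) \<inter> (pverts (graph_join G H) - (A <+> B)) = {Inl u}
      \<longleftrightarrow> B = pverts H \<and> neighbourhood G v \<inter> (pverts G - A) = {u}"
    unfolding * using assms(3) by blast
  show "neighbourhood (graph_join G H) (Inl v) \<inter> (pverts (graph_join G H) - (A <+> B)) = {Inr w}
      \<longleftrightarrow> pverts H - B = {w} \<and> neighbourhood G v \<inter> (pverts G - A) = {}"
    unfolding * by blast
qed

lemma private_neighbour_join_Inr:
  assumes "v \<in> pverts H" "A \<subseteq> pverts G" "B \<subseteq> pverts H"
  shows "neighbourhood (graph_join G H) (Inr v) \<inter> (pverts (graph_join G H) - (A <+> B)) = {Inr w}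
           \<longleftrightarrow> A = pverts G \<and> neighbourhood H v \<inter> (pverts H - B) = {w}"
    and "neighbourhood (graph_join G H) (Inr v) \<inter> (pverts (graph_join G H) - (A <+> B)) = {Inl u}
           \<longleftrightarrow> pverts G - A = {u} \<and> neighbourhood H v \<inter> (pverts H - B) = {}"
proof -
  have *: "neighbourhood (graph_join G H) (Inr v) \<inter> (pverts (graph_join G H) - (A <+> B)) =
      Inr ` (neighbourhood H v \<inter> (pverts H - B)) \<union> Inl ` (pverts G - A)"
    using assms(1) by (auto simp: neighbourhood_join_Inr pverts_graph_join)
  show "neighbourhood (graph_join G H) (Inr v) \<inter> (pverts (graph_join G H) - (A <+> B)) = {Inr w}
      \<longleftrightarrow> A = pverts G \<and> neighbourhood H v \<inter> (pverts H - B) = {w}"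
    unfolding * using assms(2) by blast
  show "neighbourhood (graph_join G H) (Inr v) \<inter> (pverts (graph_join G H) - (A <+> B)) = {Inl u}
      \<longleftrightarrow> pverts G - A = {u} \<and> neighbourhood H v \<inter> (pverts H - B) = {}"
    unfolding * by blast
qed

text \<open>
  A vertex \<open>u\<close> outside \<open>A\<close> is singled out either from its own side, by a vertex that also sees
  the whole of \<open>pverts H - B\<close>, or from the other side, by a vertex that also sees the whole of
  \<open>pverts G - A\<close>. These are the two disjuncts.
\<close>

lemma super_dominating_join_iff:
  "super_dominating (graph_join G H) (A <+> B) \<longleftrightarrow>
     A \<subseteq> pverts G \<and> B \<subseteq> pverts H \<and>
     (\<forall>u \<in> pverts G - A.
        B = pverts H \<and> (\<exists>v \<in> A. neighbourhood G v \<inter> (pverts G - A) = {u}) \<or>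
        pverts G - A = {u} \<and> (\<exists>v \<in> B. neighbourhood H v \<inter> (pverts H - B) = {})) \<and>
     (\<forall>w \<in> pverts H - B.
        A = pverts G \<and> (\<exists>v \<in> B. neighbourhood H v \<inter> (pverts H - B) = {w}) \<or>
        pverts H - B = {w} \<and> (\<exists>v \<in> A. neighbourhood G v \<inter> (pverts G - A) = {}))"
proof (cases "A \<subseteq> pverts G \<and> B \<subseteq> pverts H")
  case True
  then have A: "A \<subseteq> pverts G" and B: "B \<subseteq> pverts H" by auto
  define P where "P v t \<longleftrightarrow>
    neighbourhood (graph_join G H) v \<inter> (pverts (graph_join G H) - (A <+> B)) = {t}" for v t
  have sub: "A <+> B \<subseteq> pverts (graph_join G H)"
    using A B by (auto simp: pverts_graph_join)
  have compl: "pverts (graph_join G H) - (A <+> B) = (pverts G - A) <+> (pverts H - B)"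
    by (auto simp: pverts_graph_join)
  have P: "v \<in> A \<Longrightarrow> P (Inl v) (Inl u) \<longleftrightarrow> B = pverts H \<and> neighbourhood G v \<inter> (pverts G - A) = {u}"
    "v \<in> A \<Longrightarrow> P (Inl v) (Inr w) \<longleftrightarrow> pverts H - B = {w} \<and> neighbourhood G v \<inter> (pverts G - A) = {}"
    "y \<in> B \<Longrightarrow> P (Inr y) (Inr w) \<longleftrightarrow> A = pverts G \<and> neighbourhood H y \<inter> (pverts H - B) = {w}"
    "y \<in> B \<Longrightarrow> P (Inr y) (Inl u) \<longleftrightarrow> pverts G - A = {u} \<and> neighbourhood H y \<inter> (pverts H - B) = {}"
    for u v w y
    unfolding P_def
    by (simp_all only: private_neighbour_join_Inl[OF subsetD[OF A] A B]
        private_neighbour_join_Inr[OF subsetD[OF B] A B])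
  have "super_dominating (graph_join G H) (A <+> B) \<longleftrightarrow>
      (\<forall>t \<in> pverts (graph_join G H) - (A <+> B). \<exists>v \<in> A <+> B. P v t)"
    by (simp add: super_dominating_def sub P_def)
  also have "\<dots> \<longleftrightarrow>
      (\<forall>u \<in> pverts G - A. (\<exists>v \<in> A. P (Inl v) (Inl u)) \<or> (\<exists>v \<in> B. P (Inr v) (Inl u))) \<and>
      (\<forall>w \<in> pverts H - B. (\<exists>v \<in> A. P (Inl v) (Inr w)) \<or> (\<exists>v \<in> B. P (Inr v) (Inr w)))"
    unfolding compl unfolding Plus_def ball_Un bex_Un by simp
  finally have "super_dominating (graph_join G H) (A <+> B) \<longleftrightarrow> \<dots>" .
  moreover have "(\<exists>v \<in> A. P (Inl v) (Inl u)) \<longleftrightarrow>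
      B = pverts H \<and> (\<exists>v \<in> A. neighbourhood G v \<inter> (pverts G - A) = {u})" for u
    using P(1) by blast
  moreover have "(\<exists>v \<in> A. P (Inl v) (Inr w)) \<longleftrightarrow>
      pverts H - B = {w} \<and> (\<exists>v \<in> A. neighbourhood G v \<inter> (pverts G - A) = {})" for w
    using P(2) by blast
  moreover have "(\<exists>v \<in> B. P (Inr v) (Inr w)) \<longleftrightarrow>
      A = pverts G \<and> (\<exists>v \<in> B. neighbourhood H v \<inter> (pverts H - B) = {w})" for w
    using P(3) by blast
  moreover have "(\<exists>v \<in> B. P (Inr v) (Inl u)) \<longleftrightarrow>
      pverts G - A = {u} \<and> (\<exists>v \<in> B. neighbourhood H v \<inter> (pverts H - B) = {})" for u
    using P(4) by blast
  ultimately show ?thesis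
    using A B by (simp only: simp_thms disj_commute)
next
  case False
  then show ?thesis
    by (auto simp: super_dominating_def pverts_graph_join)
qed

text \<open>
  If vertices are missing on one side only, either all their dominators lie on that side, and
  restricting to it gives a super dominating set of the factor, or some dominator lies on the
  opposite side and, seeing all missing vertices, allows just one. If both sides miss
  vertices, every dominator lies opposite to its vertex, so each side misses just one.
\<close>

lemma super_dominating_join_cases:
  assumes "super_dominating (graph_join G H) (A <+> B)"
  obtains "B = pverts H" "super_dominating G A"
  | "A = pverts G" "super_dominating H B"
  | "card (pverts G - A) \<le> 1" "card (pverts H - B) \<le> 1"
proof -
  note D = assms[unfolded super_dominating_join_iff]
  have sub: "A \<subseteq> pverts G" "B \<subseteq> pverts H"
    using D by simp_all
  have domG: "B = pverts H \<and> (\<exists>v \<in> A. neighbourhood G v \<inter> (pverts G - A) = {u}) \<or>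
      pverts G - A = {u}" if "u \<in> pverts G - A" for u
    using D[THEN conjunct2, THEN conjunct2, THEN conjunct1, rule_format, OF that] by argo
  have domH: "A = pverts G \<and> (\<exists>v \<in> B. neighbourhood H v \<inter> (pverts H - B) = {w}) \<or>
      pverts H - B = {w}" if "w \<in> pverts H - B" for w
    using D[THEN conjunct2, THEN conjunct2, THEN conjunct2, rule_format, OF that] by argo
  consider "A = pverts G" "B = pverts H" | "A \<noteq> pverts G" "B = pverts H"
    | "A = pverts G" "B \<noteq> pverts H" | "A \<noteq> pverts G" "B \<noteq> pverts H"
    by argo
  then show thesis
  proof cases
    case 1
    then show thesis by (intro that(3)) simp_all
  next
    case 2
    show thesis
    proof (cases "\<exists>u. pverts G - A = {u}")
      case True
      then have "card (pverts G - A) \<le> 1" by force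
      then show thesis using 2 by (intro that(3)) simp_all
    next
      case False
      then have "super_dominating G A"
        using sub(1) domG unfolding super_dominating_def by meson
      then show thesis using 2 by (intro that(1))
    qed
  next
    case 3
    show thesis
    proof (cases "\<exists>w. pverts H - B = {w}")
      case True
      then have "card (pverts H - B) \<le> 1" by force
      then show thesis using 3 by (intro that(3)) simp_all
    next
      case False
      then have "super_dominating H B"
        using sub(2) domH unfolding super_dominating_def by meson
      then show thesis using 3 by (intro that(2))
    qed
  next
    case 4
    then obtain u w where "u \<in> pverts G - A" "w \<in> pverts H - B"
      using sub by blast
    then have "pverts G - A = {u}" "pverts H - B = {w}"
      using domG domH 4 by simp_all
    then show thesis by (intro that(3)) simp_all
  qed
qed

section \<open>Constructions of super dominating sets\<close>

lemma super_dominating_join_left: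
  "super_dominating G A \<Longrightarrow> super_dominating (graph_join G H) (A <+> pverts H)"
  unfolding super_dominating_join_iff by (simp add: super_dominating_def)

lemma super_dominating_join_right:
  "super_dominating H B \<Longrightarrow> super_dominating (graph_join G H) (pverts G <+> B)"
  unfolding super_dominating_join_iff by (simp add: super_dominating_def)

text \<open>
  The dominators cross over: \<open>y\<close> in \<open>H\<close> singles out \<open>u\<close> in \<open>G\<close>, and \<open>x\<close> in \<open>G\<close> singles out \<open>w\<close>
  in \<open>H\<close>. Nonadjacency to the missing vertex on its own side is what makes each one exact.
\<close>

lemma super_dominating_join_remove_pair:
  assumes "u \<in> pverts G" "x \<in> pverts G" "x \<noteq> u" "(x, u) \<notin> parcs G"
    and "w \<in> pverts H" "y \<in> pverts H" "y \<noteq> w" "(y, w) \<notin> parcs H"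
  shows "super_dominating (graph_join G H) ((pverts G - {u}) <+> (pverts H - {w}))"
proof -
  have compl: "pverts G - (pverts G - {u}) = {u}" "pverts H - (pverts H - {w}) = {w}"
    using assms by auto
  have "neighbourhood G x \<inter> {u} = {}" "neighbourhood H y \<inter> {w} = {}"
    using assms by (auto simp: neighbourhood_def)
  then show ?thesis
    using assms unfolding super_dominating_join_iff compl by blast
qed

lemma (in pair_graph) not_complete_imp_nonadjacent:
  assumes "\<not> complete_digraph (card (pverts G)) (with_proj G)"
  obtains u x where "u \<in> pverts G" "x \<in> pverts G" "x \<noteq> u" "(x, u) \<notin> parcs G"
proof -
  have "arcs_ends (with_proj G) = parcs G"
    by (simp add: arcs_ends_def arc_to_ends_def)
  moreover have "graph (with_proj G)" by unfold_locales
  ultimately have "parcs G \<noteq> {(u, v). u \<in> pverts G \<and> v \<in> pverts G \<and> u \<noteq> v}"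
    using assms by (auto simp: complete_digraph_def)
  moreover have "parcs G \<subseteq> {(u, v). u \<in> pverts G \<and> v \<in> pverts G \<and> u \<noteq> v}"
    using pair_no_loops in_arcsD1 in_arcsD2 by fastforce
  ultimately show thesis using that by blast
qed

section \<open>The super domination number of a join\<close>

lemma super_domination_number_le:
  assumes "finite (pverts G)" "super_dominating G D"
  shows "super_domination_number G \<le> card D"
  unfolding super_domination_number_def
  using assms finite_super_dominating by (intro Min_le) auto

lemma super_domination_number_witness:
  assumes "finite (pverts G)"
  obtains D where "super_dominating G D" "card D = super_domination_number G"
proof -
  have "Min (card ` {D. super_dominating G D}) \<in> card ` {D. super_dominating G D}"
    using assms finite_super_dominating super_dominating_pverts by (intro Min_in) auto
  then show thesis
    using that unfolding super_domination_number_def by (smt (verit) imageE mem_Collect_eq)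
qed

theorem theorem22:
  fixes G :: "'a pair_pre_digraph" and H :: "'b pair_pre_digraph" and n n' :: nat
  assumes "pair_graph G" and "pair_graph H"
    and "card (pverts G) = n" and "card (pverts H) = n'"
    and "parcs G \<noteq> {}" and "parcs H \<noteq> {}"
    and "\<not> complete_digraph n (with_proj G)" and "\<not> complete_digraph n' (with_proj H)"
  shows "super_domination_number (graph_join G H) =
    Min {n + n' - 2, n + super_domination_number H, n' + super_domination_number G}"
proof -
  interpret G: pair_graph G by fact
  interpret H: pair_graph H by fact
  let ?J = "graph_join G H"
  have fin: "finite (pverts ?J)"
    by (simp add: pverts_graph_join)
  have subG: "A \<subseteq> pverts G" if "super_dominating G A" for A
    using that by (simp add: super_dominating_def)
  have subH: "B \<subseteq> pverts H" if "super_dominating H B" for B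
    using that by (simp add: super_dominating_def)
  have card_Plus': "card (A <+> B) = card A + card B"
    if "A \<subseteq> pverts G" "B \<subseteq> pverts H" for A B
    using that G.pair_finite_verts H.pair_finite_verts by (simp add: card_Plus finite_subset)

  have "super_domination_number ?J \<le> n + n' - 2"
  proof -
    obtain u x where u: "u \<in> pverts G" "x \<in> pverts G" "x \<noteq> u" "(x, u) \<notin> parcs G"
      using G.not_complete_imp_nonadjacent assms(3,7) by metis
    obtain w y where w: "w \<in> pverts H" "y \<in> pverts H" "y \<noteq> w" "(y, w) \<notin> parcs H"
      using H.not_complete_imp_nonadjacent assms(4,8) by metis
    have "n > 0" "n' > 0"
      using u w assms(3,4) by (auto simp: card_gt_0_iff)
    then have "card ((pverts G - {u}) <+> (pverts H - {w})) = n + n' - 2"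
      using u w assms(3,4) by (simp add: card_Plus')
    then show ?thesis
      using super_domination_number_le[OF fin super_dominating_join_remove_pair[OF u w]] by simp
  qed
  moreover have "super_domination_number ?J \<le> n + super_domination_number H"
  proof -
    obtain B where B: "super_dominating H B" "card B = super_domination_number H"
      using super_domination_number_witness[OF H.pair_finite_verts] by blast
    show ?thesis
      using super_domination_number_le[OF fin super_dominating_join_right[OF B(1)]]
        B assms(3) by (simp add: card_Plus' subH)
  qed
  moreover have "super_domination_number ?J \<le> n' + super_domination_number G"
  proof -
    obtain A where A: "super_dominating G A" "card A = super_domination_number G"
      using super_domination_number_witness[OF G.pair_finite_verts] by blast
    show ?thesis
      using super_domination_number_le[OF fin super_dominating_join_left[OF A(1)]]
        A assms(4) by (simp add: card_Plus' subG)
  qed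
  moreover have "n + n' - 2 \<le> super_domination_number ?J \<or>
      n + super_domination_number H \<le> super_domination_number ?J \<or>
      n' + super_domination_number G \<le> super_domination_number ?J"
  proof -
    obtain D where D: "super_dominating ?J D" "card D = super_domination_number ?J"
      using super_domination_number_witness[OF fin] by blast
    define A B where "A = Inl -` D" and "B = Inr -` D"
    have split: "D = A <+> B"
    proof (rule set_eqI)
      show "t \<in> D \<longleftrightarrow> t \<in> A <+> B" for t
        by (cases t) (auto simp: A_def B_def)
    qed
    have AB: "A \<subseteq> pverts G" "B \<subseteq> pverts H"
      using D(1) by (auto simp: split super_dominating_join_iff)
    have card_D: "super_domination_number ?J = card A + card B"
      using D(2) AB by (simp add: split card_Plus')
    from D(1) have "super_dominating ?J (A <+> B)"
      by (simp add: split)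
    then show ?thesis
    proof (cases rule: super_dominating_join_cases)
      case 1
      then show ?thesis
        using super_domination_number_le[of G A] card_D assms(4) by simp
    next
      case 2
      then show ?thesis
        using super_domination_number_le[of H B] card_D assms(3) by simp
    next
      case 3
      then have "n - card A \<le> 1" "n' - card B \<le> 1"
        using AB assms(3,4) by (simp_all add: card_Diff_subset finite_subset)
      then show ?thesis
        using card_D by linarith
    qed
  qed
  ultimately show ?thesis by auto
qed

end
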